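(* $\mathcal B(L_1[0,1])$ fails the BCP.
   Context: $\mathcal B(L_1[0,1])$ is the space of bounded linear operators from $L_1[0,1]$ (Lebesgue measure) to itself with the operator norm. A normed space $X$ has the ball-covering property (BCP) if its unit sphere $S_X=\{x:\|x\|=1\}$ can be covered by countably many closed (equivalently, open) balls, none of which contains the origin. *)

theory Defs
  imports "HOL-Analysis.Analysis"
begin

definition L1_rel :: "(real \<Rightarrow> real) \<Rightarrow> (real \<Rightarrow> real) \<Rightarrow> bool" where
  "L1_rel f g \<longleftrightarrow>
     integrable (lebesgue_on {0..1}) f \<and> integrable (lebesgue_on {0..1}) g \<and>
     (AE x in lebesgue_on {0..1}. f x = g x)"

lemma part_equivp_L1_rel: "part_equivp L1_rel"
proof (rule part_equivpI)
  show "\<exists>f. L1_rel f f"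
    by (rule exI[of _ "\<lambda>_. 0"]) (simp add: L1_rel_def)
  show "symp L1_rel"
    by (rule sympI) (auto simp: L1_rel_def)
  show "transp L1_rel"
    by (rule transpI) (auto simp: L1_rel_def)
qed

text \<open>
  The real Banach space $L_1[0,1]$: Lebesgue integrable real functions on $[0,1]$ modulo
  equality almost everywhere.  Representatives are total functions on the reals, but their values
  outside $[0,1]$ are irrelevant, as the underlying space of the measure is $[0,1]$.
\<close>

quotient_type L1 = "real \<Rightarrow> real" / partial: L1_rel
  by (rule part_equivp_L1_rel)

instantiation L1 :: real_normed_vector
begin

lift_definition zero_L1 :: L1 is "\<lambda>_. 0"
  by (simp add: L1_rel_def)

lift_definition plus_L1 :: "L1 \<Rightarrow> L1 \<Rightarrow> L1" is "\<lambda>f g x. f x + g x"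
  by (auto simp: L1_rel_def)

lift_definition minus_L1 :: "L1 \<Rightarrow> L1 \<Rightarrow> L1" is "\<lambda>f g x. f x - g x"
  by (auto simp: L1_rel_def)

lift_definition uminus_L1 :: "L1 \<Rightarrow> L1" is "\<lambda>f x. - f x"
  by (auto simp: L1_rel_def)

lift_definition scaleR_L1 :: "real \<Rightarrow> L1 \<Rightarrow> L1" is "\<lambda>c f x. c * f x"
  by (auto simp: L1_rel_def)

lift_definition norm_L1 :: "L1 \<Rightarrow> real" is "\<lambda>f. integral\<^sup>L (lebesgue_on {0..1}) (\<lambda>x. \<bar>f x\<bar>)"
  by (auto simp: L1_rel_def intro!: integral_cong_AE)

definition dist_L1 :: "L1 \<Rightarrow> L1 \<Rightarrow> real" where
  "dist_L1 f g = norm (f - g)"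

definition sgn_L1 :: "L1 \<Rightarrow> L1" where
  "sgn_L1 f = scaleR (inverse (norm f)) f"

definition uniformity_L1 :: "(L1 \<times> L1) filter" where
  "uniformity_L1 = (INF e\<in>{0<..}. principal {(f, g). dist f g < e})"

definition open_L1 :: "L1 set \<Rightarrow> bool" where
  "open_L1 U \<longleftrightarrow> (\<forall>f\<in>U. \<forall>\<^sub>F (f', g) in uniformity. f' = f \<longrightarrow> g \<in> U)"

instance
proof
  fix f g h :: L1 and a b :: real and U :: "L1 set"
  show "f + g + h = f + (g + h)"
    by transfer (auto simp: L1_rel_def add.assoc)
  show "f + g = g + f"
    by transfer (auto simp: L1_rel_def add.commute)
  show "0 + f = f"
    by transfer (auto simp: L1_rel_def)
  show "- f + f = 0"
    by transfer (auto simp: L1_rel_def)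
  show "f - g = f + - g"
    by transfer (auto simp: L1_rel_def)
  show "a *\<^sub>R (f + g) = a *\<^sub>R f + a *\<^sub>R g"
    by transfer (auto simp: L1_rel_def algebra_simps)
  show "(a + b) *\<^sub>R f = a *\<^sub>R f + b *\<^sub>R f"
    by transfer (auto simp: L1_rel_def algebra_simps)
  show "a *\<^sub>R b *\<^sub>R f = (a * b) *\<^sub>R f"
    by transfer (auto simp: L1_rel_def mult.assoc)
  show "1 *\<^sub>R f = f"
    by transfer (auto simp: L1_rel_def)
  show "dist f g = norm (f - g)"
    by (rule dist_L1_def)
  show "sgn f = scaleR (inverse (norm f)) f"
    by (rule sgn_L1_def)
  show "(uniformity :: (L1 \<times> L1) filter) = (INF e\<in>{0<..}. principal {(f, g). dist f g < e})"
    by (rule uniformity_L1_def)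
  show "open U \<longleftrightarrow> (\<forall>f\<in>U. \<forall>\<^sub>F (f', g) in uniformity. f' = f \<longrightarrow> g \<in> U)"
    by (rule open_L1_def)
  show "norm f = 0 \<longleftrightarrow> f = 0"
    by transfer (auto simp: L1_rel_def integral_nonneg_eq_0_iff_AE)
  show "norm (f + g) \<le> norm f + norm g"
  proof transfer
    fix f g :: "real \<Rightarrow> real"
    assume "L1_rel f f" "L1_rel g g"
    then have f: "integrable (lebesgue_on {0..1}) f" and g: "integrable (lebesgue_on {0..1}) g"
      by (auto simp: L1_rel_def)
    have "(LINT x|lebesgue_on {0..1}. \<bar>f x + g x\<bar>) \<le> (LINT x|lebesgue_on {0..1}. \<bar>f x\<bar> + \<bar>g x\<bar>)"
      using f g by (intro integral_mono) auto
    then show "(LINT x|lebesgue_on {0..1}. \<bar>f x + g x\<bar>) \<le>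
        (LINT x|lebesgue_on {0..1}. \<bar>f x\<bar>) + (LINT x|lebesgue_on {0..1}. \<bar>g x\<bar>)"
      using f g by simp
  qed
  show "norm (a *\<^sub>R f) = \<bar>a\<bar> * norm f"
    by transfer (simp add: abs_mult)
qed

end

definition ball_covering_property :: "'a::real_normed_vector itself \<Rightarrow> bool" where
  "ball_covering_property TYPE('a) \<longleftrightarrow>
     (\<exists>B :: ('a \<times> real) set. countable B \<and>
        (\<forall>(c, r)\<in>B. r > 0 \<and> 0 \<notin> cball c r) \<and>
        sphere 0 1 \<subseteq> (\<Union>(c, r)\<in>B. cball c r))"

end

theory Submission
  imports Defs
begin

text \<open>
  If \<open>\<parallel>T\<parallel> > r\<close>, then \<open>\<parallel>T f\<parallel> > r \<parallel>f\<parallel>\<close> for some \<open>f\<close>. Since the \<open>L\<^sub>1\<close> norm is additive over disjoint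
  pieces, this strict inequality is inherited by one of the two halves of \<open>f\<close>, so by bisection
  \<open>f\<close> can be supported on an arbitrarily short interval. Given countably many balls with centres \<open>T\<^sub>n\<close>
  and radii \<open>r\<^sub>n < \<parallel>T\<^sub>n\<parallel>\<close>, choose such \<open>f\<^sub>n\<close> supported on intervals of total length less than 1,
  and let \<open>S\<close> be the restriction of functions to the complement of these intervals. Then \<open>\<parallel>S\<parallel> = 1\<close>
  and \<open>S f\<^sub>n = 0\<close>, whence \<open>\<parallel>(T\<^sub>n - S) f\<^sub>n\<parallel> = \<parallel>T\<^sub>n f\<^sub>n\<parallel> > r\<^sub>n \<parallel>f\<^sub>n\<parallel>\<close>, and \<open>S\<close> lies in none of the balls.
\<close>

lemma integrable_indicator_mult_lebesgue_on:
  fixes f :: "real \<Rightarrow> real"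
  assumes f: "integrable (lebesgue_on {0..1}) f"
  shows "integrable (lebesgue_on {0..1}) (\<lambda>x. if A \<in> sets lebesgue then indicator A x * f x else 0)"
proof (cases "A \<in> sets lebesgue")
  case True
  then have "indicator A \<in> borel_measurable (lebesgue_on {0..1})"
    by (intro measurable_restrict_space1 borel_measurable_indicator)
  then have "(\<lambda>x. indicator A x * f x) \<in> borel_measurable (lebesgue_on {0..1})"
    using f by (intro borel_measurable_times) auto
  then have "integrable (lebesgue_on {0..1}) (\<lambda>x. indicator A x * f x)"
    by (rule Bochner_Integration.integrable_bound[OF f]) (auto simp: indicator_def)
  with True show ?thesis
    by simp
qed simp

text \<open>The guard sends non-measurable \<open>A\<close> to the zero operator, so the lifting is
  defined for every set.\<close>

lift_definition restrict_L1 :: "real set \<Rightarrow> L1 \<Rightarrow> L1" is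
  "\<lambda>A f x. if A \<in> sets lebesgue then indicator A x * f x else 0"
  by (auto simp: L1_rel_def integrable_indicator_mult_lebesgue_on)

lift_definition one_L1 :: L1 is "\<lambda>_. 1"
  by (simp add: L1_rel_def)

lemma restrict_L1_add: "restrict_L1 A (f + g) = restrict_L1 A f + restrict_L1 A g"
  by transfer (auto simp: L1_rel_def integrable_indicator_mult_lebesgue_on algebra_simps)

lemma restrict_L1_scaleR: "restrict_L1 A (c *\<^sub>R f) = c *\<^sub>R restrict_L1 A f"
  by transfer (auto simp: L1_rel_def integrable_indicator_mult_lebesgue_on algebra_simps)

lemma restrict_L1_empty: "restrict_L1 {} f = 0"
  by transfer (auto simp: L1_rel_def)

text \<open>Representatives may differ off [0,1], which the underlying measure does not see. This
  starts the bisection.\<close>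

lemma restrict_L1_unit_interval: "restrict_L1 {0..1} f = f"
proof transfer
  fix f :: "real \<Rightarrow> real"
  assume "L1_rel f f"
  then have "integrable (lebesgue_on {0..1}) f"
    by (simp add: L1_rel_def)
  then show "L1_rel (\<lambda>x. if {0..1::real} \<in> sets lebesgue then indicator {0..1} x * f x else 0) f"
    using integrable_indicator_mult_lebesgue_on[of f "{0..1}"]
    by (auto simp: L1_rel_def AE_restrict_space_iff)
qed

lemma restrict_L1_restrict_L1:
  assumes "A \<in> sets lebesgue" "B \<in> sets lebesgue"
  shows "restrict_L1 A (restrict_L1 B f) = restrict_L1 (A \<inter> B) f"
proof -
  have "A \<inter> B \<in> sets lebesgue"
    using assms by blast
  then show ?thesis
    using assms
  proof transfer
    fix A B :: "real set" and f :: "real \<Rightarrow> real"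
    assume *: "A \<inter> B \<in> sets lebesgue" "A \<in> sets lebesgue" "B \<in> sets lebesgue" and "L1_rel f f"
    then have f: "integrable (lebesgue_on {0..1}) f"
      by (simp add: L1_rel_def)
    show "L1_rel
        (\<lambda>x. if A \<in> sets lebesgue then indicator A x * (if B \<in> sets lebesgue then indicator B x * f x else 0) else 0)
        (\<lambda>x. if A \<inter> B \<in> sets lebesgue then indicator (A \<inter> B) x * f x else 0)"
      using * integrable_indicator_mult_lebesgue_on[OF f, of "A \<inter> B"]
      by (simp add: L1_rel_def indicator_inter_arith mult.assoc)
  qed
qed

lemma restrict_L1_add_compl:
  assumes "A \<in> sets lebesgue"
  shows "restrict_L1 A f + restrict_L1 (- A) f = f"
proof -
  have "- A \<in> sets lebesgue"
    using assms sets.compl_sets[of A lebesgue] by (simp add: Compl_eq_Diff_UNIV)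
  then show ?thesis
    using assms
  proof transfer
    fix A :: "real set" and f :: "real \<Rightarrow> real"
    assume A: "- A \<in> sets lebesgue" "A \<in> sets lebesgue" and f: "L1_rel f f"
    have "(\<lambda>x. (if A \<in> sets lebesgue then indicator A x * f x else 0)
        + (if - A \<in> sets lebesgue then indicator (- A) x * f x else 0)) = f"
      using A by (simp add: fun_eq_iff indicator_def)
    with f show "L1_rel (\<lambda>x. (if A \<in> sets lebesgue then indicator A x * f x else 0)
        + (if - A \<in> sets lebesgue then indicator (- A) x * f x else 0)) f"
      by (simp only:)
  qed
qed

text \<open>The two pieces have disjoint supports, so their absolute values add up to that of
  \<open>f\<close> pointwise. This additivity is the feature of the L1 norm that drives the
  bisection.\<close>

lemma norm_restrict_L1_add_compl:
  assumes "A \<in> sets lebesgue"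
  shows "norm (restrict_L1 A f) + norm (restrict_L1 (- A) f) = norm f"
proof -
  have A': "- A \<in> sets lebesgue"
    using assms sets.compl_sets[of A lebesgue] by (simp add: Compl_eq_Diff_UNIV)
  show ?thesis
    using assms A'
  proof transfer
    fix A :: "real set" and f :: "real \<Rightarrow> real"
    assume A: "A \<in> sets lebesgue" "- A \<in> sets lebesgue" and "L1_rel f f"
    then have f: "integrable (lebesgue_on {0..1}) f"
      by (simp add: L1_rel_def)
    have "(LINT x|lebesgue_on {0..1}. \<bar>indicator A x * f x\<bar>)
        + (LINT x|lebesgue_on {0..1}. \<bar>indicator (- A) x * f x\<bar>)
      = (LINT x|lebesgue_on {0..1}. \<bar>indicator A x * f x\<bar> + \<bar>indicator (- A) x * f x\<bar>)"
      using A integrable_indicator_mult_lebesgue_on[OF f, of A]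
        integrable_indicator_mult_lebesgue_on[OF f, of "- A"] by simp
    also have "\<dots> = (LINT x|lebesgue_on {0..1}. \<bar>f x\<bar>)"
      by (rule Bochner_Integration.integral_cong) (auto simp: indicator_def)
    finally show "(LINT x|lebesgue_on {0..1}. \<bar>if A \<in> sets lebesgue then indicator A x * f x else 0\<bar>)
        + (LINT x|lebesgue_on {0..1}. \<bar>if - A \<in> sets lebesgue then indicator (- A) x * f x else 0\<bar>)
      = (LINT x|lebesgue_on {0..1}. \<bar>f x\<bar>)"
      using A by simp
  qed
qed

lemma norm_restrict_L1_le: "norm (restrict_L1 A f) \<le> norm f"
proof (cases "A \<in> sets lebesgue")
  case True
  then show ?thesis
    using norm_restrict_L1_add_compl[of A f] norm_ge_zero[of "restrict_L1 (- A) f"] by linarith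
next
  case False
  then have "restrict_L1 A f = 0"
    by transfer (simp add: L1_rel_def)
  then show ?thesis
    by simp
qed

lemma bounded_linear_restrict_L1: "bounded_linear (restrict_L1 A)"
  by (rule bounded_linear_intro[where K = 1])
    (simp_all add: restrict_L1_add restrict_L1_scaleR norm_restrict_L1_le)

text \<open>Shows that restricting to a set of positive measure leaves a nonzero vector, which later
  bounds an operator norm from below.\<close>

lemma norm_restrict_L1_one:
  assumes "A \<in> sets lebesgue" "A \<subseteq> {0..1}"
  shows "norm (restrict_L1 A one_L1) = measure lebesgue A"
  using assms
proof transfer
  fix A :: "real set"
  assume A: "A \<in> sets lebesgue" "A \<subseteq> {0..1}"
  have "(LINT x|lebesgue_on {0..1}. indicator A x :: real) = measure (lebesgue_on {0..1}) A"
    using A by (simp add: Int_absorb2)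
  also have "\<dots> = measure lebesgue A"
    using A by (intro measure_restrict_space) auto
  finally show "(LINT x|lebesgue_on {0..1}. \<bar>if A \<in> sets lebesgue then indicator A x * 1 else 0 :: real\<bar>)
      = measure lebesgue A"
    using A by simp
qed

lemma norm_gt_on_short_interval:
  fixes T :: "L1 \<Rightarrow>\<^sub>L 'b::real_normed_vector"
  assumes r: "0 \<le> r" "r < norm T"
  shows "\<exists>a b f. a \<le> b \<and> b - a \<le> (1/2) ^ n \<and> restrict_L1 {a..b} f = f \<and> r * norm f < norm (T f)"
proof (induction n)
  case 0
  \<comment> \<open>Otherwise \<open>r\<close> would bound \<open>T\<close>, giving
    \<open>norm T \<le> r\<close>.\<close>
  obtain f where "r * norm f < norm (T f)"
    using norm_blinfun_bound[of r T] r by (auto simp: not_le[symmetric])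
  then show ?case
    by (intro exI[of _ 0] exI[of _ 1] exI[of _ f]) (simp add: restrict_L1_unit_interval)
next
  case (Suc n)
  then obtain a b f where ab: "a \<le> b" "b - a \<le> (1/2) ^ n" and f: "restrict_L1 {a..b} f = f"
    and gt: "r * norm f < norm (T f)"
    by blast
  define m where "m = (a + b) / 2"
  let ?g = "restrict_L1 {..m} f" and ?h = "restrict_L1 (- {..m}) f"
  have len: "m - a \<le> (1/2) ^ Suc n" "b - m \<le> (1/2) ^ Suc n" "a \<le> m" "m \<le> b"
    using ab by (auto simp: m_def field_simps)
  have g: "restrict_L1 {a..m} ?g = ?g"
  proof -
    \<comment> \<open>Writing \<open>f\<close> as its own restriction to \<open>{a..b}\<close> turns
      the claim into an identity between intersections of sets.\<close>
    have "{a..m} \<inter> {..m} \<inter> {a..b} = {..m} \<inter> {a..b}"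
      using len by auto
    then show ?thesis
      by (subst (1 2) f[symmetric]) (simp add: restrict_L1_restrict_L1 Int_assoc sets.Int)
  qed
  have h: "restrict_L1 {m..b} ?h = ?h"
  proof -
    have "{m..b} \<inter> (- {..m} \<inter> {a..b}) = - {..m} \<inter> {a..b}"
      using len by auto
    then show ?thesis
      by (subst (1 2) f[symmetric]) (simp add: restrict_L1_restrict_L1 sets.Int)
  qed
  \<comment> \<open>If both halves failed, adding their inequalities would give
    \<open>norm (T f) \<le> r * norm f\<close> by additivity of the norm.\<close>
  have "r * norm ?g < norm (T ?g) \<or> r * norm ?h < norm (T ?h)"
  proof (rule ccontr)
    assume "\<not> ?thesis"
    then have "norm (T ?g) + norm (T ?h) \<le> r * (norm ?g + norm ?h)"
      by (simp add: algebra_simps)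
    moreover have "norm ?g + norm ?h = norm f"
      by (intro norm_restrict_L1_add_compl) auto
    moreover have "T f = T ?g + T ?h"
      using restrict_L1_add_compl[of "{..m}" f] by (simp del: Compl_atMost flip: blinfun.add_right)
    ultimately show False
      using gt norm_triangle_ineq[of "T ?g" "T ?h"] by simp
  qed
  then show ?case
    using g h len(1,2,3,4) by blast
qed

theorem corollary3p2: "\<not> ball_covering_property TYPE(L1 \<Rightarrow>\<^sub>L L1)"
proof
  assume "ball_covering_property TYPE(L1 \<Rightarrow>\<^sub>L L1)"
  then obtain B :: "((L1 \<Rightarrow>\<^sub>L L1) \<times> real) set" where B: "countable B"
    \<comment> \<open>The origin lies outside \<open>cball T r\<close> exactly when
      \<open>r < norm T\<close>.\<close>
    and away: "\<And>T r. (T, r) \<in> B \<Longrightarrow> r > 0 \<and> r < norm T"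
    and cover: "sphere 0 1 \<subseteq> (\<Union>(T, r)\<in>B. cball T r)"
    unfolding ball_covering_property_def by fastforce
  \<comment> \<open>The shift by 2 in the exponent keeps the total length at most 1/2.\<close>
  have "\<exists>a b f. a \<le> b \<and> b - a \<le> (1/2) ^ (to_nat_on B p + 2) \<and> restrict_L1 {a..b} f = f
      \<and> snd p * norm f < norm (fst p f)" if "p \<in> B" for p
    using away[of "fst p" "snd p"] that
    by (intro norm_gt_on_short_interval) auto
  then obtain a b f where ab: "\<And>p. p \<in> B \<Longrightarrow> a p \<le> b p"
    and len: "\<And>p. p \<in> B \<Longrightarrow> b p - a p \<le> (1/2) ^ (to_nat_on B p + 2)"
    and supp: "\<And>p. p \<in> B \<Longrightarrow> restrict_L1 {a p..b p} (f p) = f p"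
    and gt: "\<And>p. p \<in> B \<Longrightarrow> snd p * norm (f p) < norm (fst p (f p))"
    by metis
  define U where "U = (\<Union>p\<in>B. {a p..b p})"
  define C where "C = {0..1} - U"
  have U: "U \<in> sets lebesgue"
    unfolding U_def using B by (intro sets.countable_UN') auto
  then have C: "C \<in> sets lebesgue"
    by (auto simp: C_def)
  \<comment> \<open>Reindexes the intervals by all naturals for countable subadditivity; indices
    outside the enumeration, as when \<open>B\<close> is finite, get the empty set.\<close>
  define A where "A i = (if i \<in> to_nat_on B ` B
    then {a (from_nat_into B i)..b (from_nat_into B i)} else {})" for i
  have A_len: "emeasure lebesgue (A i) \<le> ennreal ((1/2) ^ (i + 2))" for i
    using ab len B by (auto simp: A_def intro!: ennreal_leI)
  have "(\<lambda>i. (1/2) ^ (i + 2)) sums (1/2 :: real)"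
    using sums_mult[OF geometric_sums[of "1/2 :: real"], of "1/4"]
    by (simp add: power_add mult.commute)
  then have geometric: "(\<Sum>i. ennreal ((1/2) ^ (i + 2))) = ennreal (1/2)"
    by (intro suminf_ennreal_eq) auto
  have "U = (\<Union>i. A i)"
    using B by (auto simp: U_def A_def)
  also have "emeasure lebesgue \<dots> \<le> (\<Sum>i. emeasure lebesgue (A i))"
    by (rule emeasure_subadditive_countably) (auto simp: A_def)
  also have "\<dots> \<le> (\<Sum>i. ennreal ((1/2) ^ (i + 2)))"
    by (intro suminf_le A_len) auto
  finally have small: "emeasure lebesgue U \<le> ennreal (1/2)"
    by (simp only: geometric)
  \<comment> \<open>\<open>C\<close> and \<open>U\<close> cover [0,1], so a null \<open>C\<close>
    would force 1 \<le> 1/2. The additive form avoids subtraction in \<open>ennreal\<close>.\<close>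
  have "ennreal 1 = emeasure lebesgue {0..1::real}"
    by simp
  also have "\<dots> \<le> emeasure lebesgue (C \<union> U)"
    using C U by (intro emeasure_mono) (auto simp: C_def)
  also have "\<dots> \<le> emeasure lebesgue C + emeasure lebesgue U"
    using C U by (rule emeasure_subadditive)
  also have "\<dots> \<le> emeasure lebesgue C + ennreal (1/2)"
    using small by (rule add_left_mono)
  finally have one_le: "ennreal 1 \<le> emeasure lebesgue C + ennreal (1/2)" .
  have "emeasure lebesgue C \<noteq> 0"
  proof
    assume "emeasure lebesgue C = 0"
    with one_le have "ennreal 1 \<le> ennreal (1/2)"
      by (simp only: add_0)
    then show False
      by (subst (asm) ennreal_le_iff) auto
  qed
  moreover have "C \<in> lmeasurable"
    using U by (auto simp: C_def intro: fmeasurable_Diff)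
  ultimately have "measure lebesgue C > 0"
    by (simp add: emeasure_eq_measure2 zero_less_measure_iff)
  define S where "S = Blinfun (restrict_L1 C)"
  have S: "S g = restrict_L1 C g" for g
    by (simp add: S_def bounded_linear_Blinfun_apply bounded_linear_restrict_L1)
  have "norm S = 1"
  proof (rule antisym)
    show "norm S \<le> 1"
      by (rule norm_blinfun_bound) (simp_all add: S norm_restrict_L1_le)
    \<comment> \<open>\<open>S\<close> fixes this vector, which is nonzero because \<open>C\<close>
      has positive measure.\<close>
    let ?g = "restrict_L1 C one_L1"
    have "norm ?g = norm (S ?g)"
      by (simp add: S restrict_L1_restrict_L1 C)
    also have "\<dots> \<le> norm S * norm ?g"
      by (rule norm_blinfun)
    finally show "1 \<le> norm S"
      using \<open>measure lebesgue C > 0\<close> norm_restrict_L1_one[of C] C by (simp add: C_def)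
  qed
  then obtain T r where p: "(T, r) \<in> B" and near: "norm (T - S) \<le> r"
    using cover by (fastforce simp: dist_norm)
  let ?f = "f (T, r)"
  \<comment> \<open>The vector chosen for this ball lives on an interval removed from
    \<open>C\<close>, so \<open>S\<close> kills it and \<open>T - S\<close> acts on it as
    \<open>T\<close> does.\<close>
  have "S ?f = restrict_L1 (C \<inter> {a (T, r)..b (T, r)}) ?f"
    by (subst supp[OF p, symmetric]) (simp add: S restrict_L1_restrict_L1 C)
  also have "C \<inter> {a (T, r)..b (T, r)} = {}"
    using p by (auto simp: C_def U_def)
  finally have "S ?f = 0"
    by (simp add: restrict_L1_empty)
  then have "norm (T ?f) = norm ((T - S) ?f)"
    by (simp add: blinfun.diff_left)
  also have "\<dots> \<le> norm (T - S) * norm ?f"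
    by (rule norm_blinfun)
  also have "\<dots> \<le> r * norm ?f"
    using near by (intro mult_right_mono) auto
  finally show False
    using gt[OF p] by simp
qed

end
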